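(* Over the space $\mathcal{D}$, the topology $\mathbb{T}_V$ generated by the symmetric-difference metric is strictly coarser than the topology $\mathbb{T}_H$ generated by the Hausdorff metric.
   Context: Fix $n\ge 2$; $\mathbb{E}^n$ is $n$-dimensional Euclidean space with distance $d$; $v$ is $n$-dimensional volume. A region is a nonempty bounded open subset of $\mathbb{E}^n$ equal to the interior of its closure. $\mathcal{C}$ is the set of convex regions; for regions $X,Y$, $d(X,Y)=\min_{x\in\bar X,y\in\bar Y}d(x,y)$; $\mathcal{D}^2=\{X\cup Y: X,Y\in\mathcal{C},\ d(X,Y)>0\}$; $\mathcal{D}=\mathcal{C}\cup\mathcal{D}^2$. For a point $p$ and region $Q$, $d(p,Q)=\min_{q\in\bar Q}d(p,q)$; $H^1(P,Q)=\sup_{p\in P}d(p,Q)$; the Hausdorff metric is $H(P,Q)=\max(H^1(P,Q),H^1(Q,P))$. The symmetric-difference metric is $V(P,Q)=v((P\setminus Q)\cup(Q\setminus P))$. Both metrics are restricted to $\mathcal{D}$. *)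

theory Defs
  imports "HOL-Analysis.Analysis"
begin

definition region :: "'a::euclidean_space set \<Rightarrow> bool" where
  "region X \<longleftrightarrow> X \<noteq> {} \<and> bounded X \<and> open X \<and> X = interior (closure X)"

definition convex_regions :: "'a::euclidean_space set set" where
  "convex_regions = {X. region X \<and> convex X}"

(* For nonempty bounded sets the closures are compact, so the infima in setdist and infdist
   below are attained and agree with the minima in the usual definitions. *)

definition region_dist :: "'a::euclidean_space set \<Rightarrow> 'a set \<Rightarrow> real" where
  "region_dist X Y = setdist (closure X) (closure Y)"

definition convex_region_pairs :: "'a::euclidean_space set set" where
  "convex_region_pairs =
     {X \<union> Y | X Y. X \<in> convex_regions \<and> Y \<in> convex_regions \<and> region_dist X Y > 0}"

definition region_space :: "'a::euclidean_space set set" where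
  "region_space = convex_regions \<union> convex_region_pairs"

definition point_region_dist :: "'a::euclidean_space \<Rightarrow> 'a set \<Rightarrow> real" where
  "point_region_dist p Q = infdist p (closure Q)"

definition hausdorff_semidist :: "'a::euclidean_space set \<Rightarrow> 'a set \<Rightarrow> real" where
  "hausdorff_semidist P Q = (SUP p\<in>P. point_region_dist p Q)"

definition hausdorff_dist :: "'a::euclidean_space set \<Rightarrow> 'a set \<Rightarrow> real" where
  "hausdorff_dist P Q = max (hausdorff_semidist P Q) (hausdorff_semidist Q P)"

definition symdiff_dist :: "'a::euclidean_space set \<Rightarrow> 'a set \<Rightarrow> real" where
  "symdiff_dist P Q = measure lborel ((P - Q) \<union> (Q - P))"

(* The locale Metric_space demands nonnegativity on the whole type, whereas a supremum over an
   empty or unbounded set has an unspecified real value. Off the carrier the distance is therefore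
   set to 0, which does not affect the metric topology on the carrier. *)

definition restrict_dist :: "'b set \<Rightarrow> ('b \<Rightarrow> 'b \<Rightarrow> real) \<Rightarrow> 'b \<Rightarrow> 'b \<Rightarrow> real" where
  "restrict_dist M d = (\<lambda>x y. if x \<in> M \<and> y \<in> M then d x y else 0)"

definition hausdorff_topology :: "'a::euclidean_space set topology" where
  "hausdorff_topology =
     Metric_space.mtopology region_space (restrict_dist region_space hausdorff_dist)"

definition symdiff_topology :: "'a::euclidean_space set topology" where
  "symdiff_topology =
     Metric_space.mtopology region_space (restrict_dist region_space symdiff_dist)"

definition strictly_coarser :: "'b topology \<Rightarrow> 'b topology \<Rightarrow> bool" where
  "strictly_coarser S T \<longleftrightarrow> {U. openin S U} \<subset> {U. openin T U}"

lemma region_Un: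
  assumes "region X" "region Y" "region_dist X Y > 0"
  shows "region (X \<union> Y)"
proof -
  have disj: "closure X \<inter> closure Y = {}"
    using assms(3) setdist_eq_0I unfolding region_dist_def by fastforce
  have sub: "interior (A \<union> B) \<subseteq> interior A \<union> interior B"
    if "closed A" "closed B" "A \<inter> B = {}" for A B :: "'a set"
  proof
    fix x assume x: "x \<in> interior (A \<union> B)"
    have "interior (A \<union> B) - B \<subseteq> interior A"
      by (rule interior_maximal) (use interior_subset[of "A \<union> B"] that in \<open>auto intro: open_Diff\<close>)
    moreover have "interior (A \<union> B) - A \<subseteq> interior B"
      by (rule interior_maximal) (use interior_subset[of "A \<union> B"] that in \<open>auto intro: open_Diff\<close>)
    ultimately show "x \<in> interior A \<union> interior B"
      using x that(3) by blast
  qed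
  have "interior (closure (X \<union> Y)) \<subseteq> X \<union> Y"
    using sub[OF closed_closure closed_closure disj] assms unfolding region_def closure_Un by blast
  moreover have "X \<union> Y \<subseteq> interior (closure (X \<union> Y))"
    using assms by (intro interior_maximal closure_subset) (auto simp: region_def)
  ultimately show ?thesis
    using assms by (auto simp: region_def)
qed

lemma region_space_region: "P \<in> region_space \<Longrightarrow> region P"
  by (auto simp: region_space_def convex_regions_def convex_region_pairs_def region_Un)

lemma point_region_dist_le_semidist:
  assumes "region P" "region Q" "p \<in> closure P"
  shows "point_region_dist p Q \<le> hausdorff_semidist P Q"
proof -
  have bdd: "bdd_above ((\<lambda>p. point_region_dist p Q) ` P)"
  proof -
    obtain q where q: "q \<in> Q" using assms by (auto simp: region_def)
    obtain r where r: "\<forall>x\<in>P. dist q x \<le> r"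
      using assms bounded_any_center[of P q] by (auto simp: region_def)
    have "point_region_dist p Q \<le> r" if "p \<in> P" for p
      unfolding point_region_dist_def
      using infdist_le2[of q "closure Q" p r] q r that closure_subset[of Q] by (auto simp: dist_commute)
    then show ?thesis by (intro bdd_aboveI2)
  qed
  have "P \<subseteq> {p. infdist p (closure Q) \<le> hausdorff_semidist P Q}"
    using bdd unfolding hausdorff_semidist_def point_region_dist_def by (auto intro: cSUP_upper)
  moreover have "closed {p. infdist p (closure Q) \<le> hausdorff_semidist P Q}"
    by (intro closed_Collect_le continuous_intros)
  ultimately show ?thesis
    using assms(3) closure_minimal unfolding point_region_dist_def by blast
qed

lemma hausdorff_semidist_nonneg:
  assumes "region P" "region Q"
  shows "0 \<le> hausdorff_semidist P Q"
proof -
  obtain p where "p \<in> P" using assms by (auto simp: region_def)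
  then show ?thesis
    using point_region_dist_le_semidist[OF assms, of p] closure_subset[of P]
      infdist_nonneg[of p "closure Q"] unfolding point_region_dist_def by auto
qed

lemma hausdorff_semidist_le_0_imp_subset:
  assumes "region P" "region Q" "hausdorff_semidist P Q \<le> 0"
  shows "P \<subseteq> Q"
proof -
  have "p \<in> closure Q" if "p \<in> closure P" for p
  proof -
    have "infdist p (closure Q) = 0"
      using point_region_dist_le_semidist[OF assms(1,2) that] assms(3)
        infdist_nonneg[of p "closure Q"] unfolding point_region_dist_def by linarith
    moreover have "closure Q \<noteq> {}" using assms by (auto simp: region_def)
    ultimately show ?thesis using in_closed_iff_infdist_zero[of "closure Q" p] by simp
  qed
  then have "interior (closure P) \<subseteq> interior (closure Q)"
    by (intro interior_mono) auto
  then show ?thesis using assms by (simp add: region_def)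
qed

lemma hausdorff_semidist_triangle:
  assumes "region P" "region Q" "region R"
  shows "hausdorff_semidist P R \<le> hausdorff_semidist P Q + hausdorff_semidist Q R"
proof -
  have "point_region_dist p R \<le> hausdorff_semidist P Q + hausdorff_semidist Q R" if "p \<in> P" for p
  proof -
    have "closure Q \<noteq> {}" using assms by (auto simp: region_def)
    then obtain q where q: "q \<in> closure Q" "infdist p (closure Q) = dist p q"
      using infdist_attains_inf[of "closure Q" p] by auto
    have "infdist p (closure R) \<le> infdist q (closure R) + dist p q"
      by (rule infdist_triangle)
    moreover have "infdist q (closure R) \<le> hausdorff_semidist Q R"
      using point_region_dist_le_semidist[OF assms(2,3) q(1)] by (simp add: point_region_dist_def)
    moreover have "dist p q \<le> hausdorff_semidist P Q"
      using point_region_dist_le_semidist[OF assms(1,2), of p] that closure_subset[of P] q(2)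
      by (auto simp: point_region_dist_def)
    ultimately show ?thesis by (simp add: point_region_dist_def)
  qed
  moreover have "P \<noteq> {}" using assms by (auto simp: region_def)
  ultimately show ?thesis
    unfolding hausdorff_semidist_def[of P R] by (intro cSUP_least)
qed

lemma hausdorff_semidist_self:
  assumes "region P"
  shows "hausdorff_semidist P P = 0"
proof -
  have "hausdorff_semidist P P = (SUP p\<in>P. 0)"
    unfolding hausdorff_semidist_def point_region_dist_def
    using closure_subset[of P] by (intro SUP_cong) auto
  then show ?thesis using assms by (simp add: region_def)
qed

lemma Metric_space_hausdorff_dist:
  "Metric_space (region_space :: 'a::euclidean_space set set) (restrict_dist region_space hausdorff_dist)"
proof
  fix P Q R :: "'a set"
  show "0 \<le> restrict_dist region_space hausdorff_dist P Q"
    by (auto simp: restrict_dist_def hausdorff_dist_def le_max_iff_disj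
        intro: hausdorff_semidist_nonneg region_space_region)
  show "restrict_dist region_space hausdorff_dist P Q = restrict_dist region_space hausdorff_dist Q P"
    by (simp add: restrict_dist_def hausdorff_dist_def max.commute)
  assume P: "P \<in> region_space" and Q: "Q \<in> region_space"
  show "restrict_dist region_space hausdorff_dist P Q = 0 \<longleftrightarrow> P = Q"
  proof
    assume "restrict_dist region_space hausdorff_dist P Q = 0"
    then have "hausdorff_semidist P Q \<le> 0" "hausdorff_semidist Q P \<le> 0"
      using P Q by (auto simp: restrict_dist_def hausdorff_dist_def)
    then show "P = Q"
      using hausdorff_semidist_le_0_imp_subset region_space_region P Q by blast
  qed (use P in \<open>simp add: restrict_dist_def hausdorff_dist_def hausdorff_semidist_self region_space_region\<close>)
  assume R: "R \<in> region_space"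
  show "restrict_dist region_space hausdorff_dist P R
      \<le> restrict_dist region_space hausdorff_dist P Q + restrict_dist region_space hausdorff_dist Q R"
    using hausdorff_semidist_triangle[of P Q R] hausdorff_semidist_triangle[of R Q P]
      region_space_region[OF P] region_space_region[OF Q] region_space_region[OF R] P Q R
    by (auto simp: restrict_dist_def hausdorff_dist_def)
qed

lemma symdiff_dist_0_imp_subset:
  assumes "region P" "region Q" "symdiff_dist P Q = 0"
  shows "P \<subseteq> Q"
proof -
  let ?S = "(P - Q) \<union> (Q - P)"
  have meas: "P \<in> lmeasurable" "Q \<in> lmeasurable" using assms by (auto simp: region_def lmeasurable_open)
  then have S: "?S \<in> lmeasurable" by (intro fmeasurable.Un fmeasurable_Diff) auto
  have "measure lebesgue ?S = 0"
    using assms(3) assms(1,2) unfolding symdiff_dist_def region_def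
    by (subst measure_completion) auto
  then have "negligible ?S" using S negligible_iff_measure0 by blast
  then have "negligible (P - closure Q)"
    using closure_subset[of Q] by (elim negligible_subset) auto
  moreover have "open (P - closure Q)" using assms by (auto simp: region_def intro!: open_Diff)
  ultimately have "P \<subseteq> closure Q" using open_not_negligible by blast
  then have "P \<subseteq> interior (closure Q)" using assms by (intro interior_maximal) (auto simp: region_def)
  then show ?thesis using assms by (simp add: region_def)
qed

lemma symdiff_dist_triangle:
  assumes "region P" "region Q" "region R"
  shows "symdiff_dist P R \<le> symdiff_dist P Q + symdiff_dist Q R"
proof -
  have m: "P \<in> sets borel" "Q \<in> sets borel" "R \<in> sets borel"
    using assms by (auto simp: region_def)
  have f: "(A - B) \<union> (B - A) \<in> fmeasurable lborel" if "region A" "region B" for A B :: "'a set"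
  proof (rule fmeasurableI)
    show "(A - B) \<union> (B - A) \<in> sets lborel" using that by (auto simp: region_def)
    have "bounded ((A - B) \<union> (B - A))" using that
      by (auto simp: region_def intro: bounded_subset)
    then show "emeasure lborel ((A - B) \<union> (B - A)) < \<infinity>" by (rule emeasure_bounded_finite)
  qed
  have "symdiff_dist P R
      \<le> measure lborel (((P - Q) \<union> (Q - P)) \<union> ((Q - R) \<union> (R - Q)))"
    unfolding symdiff_dist_def
    using m fmeasurable.Un[OF f[OF assms(1,2)] f[OF assms(2,3)]]
    by (intro measure_mono_fmeasurable) auto
  also have "\<dots> \<le> symdiff_dist P Q + symdiff_dist Q R"
    unfolding symdiff_dist_def using m by (intro measure_Un_le) auto
  finally show ?thesis .
qed

lemma Metric_space_symdiff_dist: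
  "Metric_space (region_space :: 'a::euclidean_space set set) (restrict_dist region_space symdiff_dist)"
proof
  have sym: "symdiff_dist P Q = symdiff_dist Q P" for P Q :: "'a set"
    by (simp add: symdiff_dist_def Un_commute)
  fix P Q R :: "'a set"
  show "0 \<le> restrict_dist region_space symdiff_dist P Q"
    by (simp add: restrict_dist_def symdiff_dist_def)
  show "restrict_dist region_space symdiff_dist P Q = restrict_dist region_space symdiff_dist Q P"
    by (simp add: restrict_dist_def sym)
  assume P: "P \<in> region_space" and Q: "Q \<in> region_space"
  show "restrict_dist region_space symdiff_dist P Q = 0 \<longleftrightarrow> P = Q"
  proof
    assume "restrict_dist region_space symdiff_dist P Q = 0"
    then have "symdiff_dist P Q = 0" using P Q by (simp add: restrict_dist_def)
    then show "P = Q"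
      using symdiff_dist_0_imp_subset region_space_region P Q sym by (metis subset_antisym)
  qed (simp add: restrict_dist_def symdiff_dist_def)
  assume R: "R \<in> region_space"
  show "restrict_dist region_space symdiff_dist P R
      \<le> restrict_dist region_space symdiff_dist P Q + restrict_dist region_space symdiff_dist Q R"
    using symdiff_dist_triangle[of P Q R] region_space_region[OF P] region_space_region[OF Q]
      region_space_region[OF R] P Q R
    by (simp add: restrict_dist_def)
qed

end

theory Submission
  imports Defs
begin

text \<open>If \<open>Q\<close> is Hausdorff-close to \<open>P\<close>, then \<open>Q - P\<close> lies in a thin outer layer around \<open>P\<close>, whose
  volume tends to \<open>0\<close> because frontiers of convex sets are null sets. For \<open>P - Q\<close> with
  \<open>Q = X \<union> Y\<close>, the part near the boundary of \<open>P\<close> has small volume, and the part deep inside \<open>P\<close>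
  lies in the gap between the convex sets \<open>X\<close> and \<open>Y\<close>, hence in a thin slab. Conversely, adding
  to a ball a tiny ball at a fixed distance is a small change in volume but not in the Hausdorff
  metric.\<close>

section \<open>Distance functions and small sublevel sets\<close>

lemma infdist_closure: "infdist x (closure A) = infdist x A"
  by (simp add: infdist_eq_setdist)

lemma infdist_borel: "(\<lambda>x. infdist x A) \<in> borel_measurable borel"
  by (intro borel_measurable_continuous_onI continuous_intros)

text \<open>Continuity of the measure from above: the sublevel sets for \<open>1/(k+1)\<close>
  decrease to the empty set because \<open>f\<close> is positive on \<open>S\<close>. With
  \<open>f\<close> a distance function this bounds the volume of thin layers on either side of a
  boundary.\<close>

lemma sublevel_measure_small:
  fixes f :: "'a::euclidean_space \<Rightarrow> real"
  assumes S: "S \<in> fmeasurable lborel" and f: "f \<in> borel_measurable borel"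
    and pos: "\<And>x. x \<in> S \<Longrightarrow> f x > 0" and "\<epsilon> > 0"
  obtains r where "r > 0" "measure lborel {x \<in> S. f x \<le> r} < \<epsilon>"
proof -
  let ?A = "\<lambda>k::nat. {x \<in> S. f x \<le> inverse (real (Suc k))}"
  have Sb: "S \<in> sets borel" using S by auto
  have A: "?A k \<in> fmeasurable lborel" for k
  proof (rule fmeasurableI2[OF S])
    have "?A k = S \<inter> {x \<in> space borel. f x \<le> inverse (real (Suc k))}" by auto
    also have "\<dots> \<in> sets borel" using Sb f by measurable
    finally show "?A k \<in> sets lborel" by simp
  qed auto
  have "(\<lambda>k. measure lborel (?A k)) \<longlonglongrightarrow> measure lborel (\<Inter>k. ?A k)"
  proof (rule Lim_measure_decseq)
    show "range ?A \<subseteq> sets lborel" using A by (auto simp: fmeasurable_def)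
    show "decseq ?A"
    proof (rule decseq_SucI)
      fix k
      have "inverse (real (Suc (Suc k))) \<le> inverse (real (Suc k))"
        by (intro le_imp_inverse_le) auto
      then show "?A (Suc k) \<subseteq> ?A k" by (blast intro: order_trans)
    qed
    show "emeasure lborel (?A k) \<noteq> \<infinity>" for k
      using A[of k] by (auto simp: fmeasurable_def)
  qed
  moreover have "(\<Inter>k. ?A k) = {}"
  proof -
    have False if x: "\<forall>k. x \<in> ?A k" for x
    proof -
      have "f x > 0" using x pos by auto
      then obtain k where "inverse (real (Suc k)) < f x" using reals_Archimedean by blast
      moreover have "x \<in> ?A k" using x by blast
      ultimately show False by simp
    qed
    then show ?thesis by blast
  qed
  ultimately have "(\<lambda>k. measure lborel (?A k)) \<longlonglongrightarrow> 0" by simp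
  then have "\<forall>\<^sub>F k in sequentially. measure lborel (?A k) < \<epsilon>"
    using \<open>\<epsilon> > 0\<close> by (rule order_tendstoD)
  then obtain k where "measure lborel (?A k) < \<epsilon>"
    by (auto simp: eventually_sequentially)
  then show thesis by (intro that[of "inverse (real (Suc k))"]) auto
qed

section \<open>Volume of thin slabs\<close>

lemma fmeasurable_bounded_borel:
  fixes S :: "'a::euclidean_space set"
  assumes "S \<in> sets borel" "bounded S"
  shows "S \<in> fmeasurable lborel"
  using assms emeasure_bounded_finite by (intro fmeasurableI) auto

text \<open>The disjoint translates of the slab by multiples of \<open>7 r u\<close> all fit into a ball of radius \<open>R + 1\<close>.\<close>

lemma slab_measure_le:
  fixes u p :: "'a::euclidean_space" and R :: real
  assumes u: "norm u = 1" and r: "r > 0" and N: "7 * r * real N \<le> 1"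
  defines "S \<equiv> {x \<in> ball 0 R. \<bar>u \<bullet> (x - p)\<bar> \<le> 3 * r}"
  shows "real N * measure lborel S \<le> measure lborel (ball (0::'a) (R + 1))"
proof -
  have uu: "u \<bullet> u = 1" using u by (simp add: dot_square_norm)
  let ?T = "\<lambda>j::nat. (+) ((7 * r * real j) *\<^sub>R u) ` S"
  have Sb: "S \<in> sets borel"
  proof -
    have "S = ball 0 R \<inter> {x. \<bar>u \<bullet> (x - p)\<bar> \<le> 3 * r}" by (auto simp: S_def)
    moreover have "closed {x. \<bar>u \<bullet> (x - p)\<bar> \<le> 3 * r}"
      by (intro closed_Collect_le continuous_intros)
    ultimately show ?thesis by auto
  qed
  have T: "?T j = (\<lambda>x. x - (7 * r * real j) *\<^sub>R u) -` S" for j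
  proof (intro equalityI subsetI)
    fix x assume "x \<in> (\<lambda>x. x - (7 * r * real j) *\<^sub>R u) -` S"
    then show "x \<in> ?T j"
      by (intro image_eqI[of _ _ "x - (7 * r * real j) *\<^sub>R u"]) auto
  qed auto
  have Tb: "?T j \<in> sets borel" for j
  proof -
    have "(\<lambda>x::'a. x - (7 * r * real j) *\<^sub>R u) \<in> borel_measurable borel" by measurable
    from measurable_sets[OF this Sb] show ?thesis unfolding T by simp
  qed
  have bS: "bounded S" by (rule bounded_subset[of "ball 0 R"]) (auto simp: S_def)
  have Tf: "?T j \<in> fmeasurable lborel" for j
    using Tb bS by (intro fmeasurable_bounded_borel bounded_translation) auto
  have mT: "measure lborel (?T j) = measure lborel S" for j
  proof -
    have "measure lebesgue (?T j) = measure lebesgue S" by (rule measure_translation)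
    then show ?thesis using Tb[of j] Sb by (simp add: measure_completion)
  qed
  have disj: "disjoint_family_on ?T {..<N}"
    unfolding disjoint_family_on_def
  proof (intro ballI impI)
    fix i j :: nat assume ij: "i \<noteq> j"
    have False if "x \<in> S" "y \<in> S" "(7 * r * real i) *\<^sub>R u + x = (7 * r * real j) *\<^sub>R u + y" for x y
    proof -
      have "u \<bullet> ((7 * r * real i) *\<^sub>R u + x) = u \<bullet> ((7 * r * real j) *\<^sub>R u + y)" using that by simp
      then have e: "7 * r * real i + u \<bullet> x = 7 * r * real j + u \<bullet> y"
        by (simp add: inner_add_right uu)
      \<comment> \<open>The slab has width \<open>6 * r\<close> along \<open>u\<close>, strictly
        less than the step \<open>7 * r\<close> between consecutive translates.\<close>
      have "\<bar>u \<bullet> x - u \<bullet> y\<bar> \<le> 6 * r"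
        using that(1,2) by (auto simp: S_def inner_diff_right)
      moreover have "\<bar>real i - real j\<bar> \<ge> 1" using ij by linarith
      then have "7 * r * \<bar>real i - real j\<bar> \<ge> 7 * r * 1" using r by (intro mult_left_mono) auto
      moreover have "7 * r * \<bar>real i - real j\<bar> = \<bar>u \<bullet> x - u \<bullet> y\<bar>"
      proof -
        have "7 * r * \<bar>real i - real j\<bar> = \<bar>7 * r * (real i - real j)\<bar>" using r by (simp add: abs_mult)
        also have "7 * r * (real i - real j) = u \<bullet> y - u \<bullet> x" using e by (simp add: algebra_simps)
        finally show ?thesis by simp
      qed
      ultimately show False using r by linarith
    qed
    then show "?T i \<inter> ?T j = {}" by blast
  qed
  have "real N * measure lborel S = (\<Sum>j<N. measure lborel (?T j))" by (simp add: mT)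
  also have "\<dots> = measure lborel (\<Union>j<N. ?T j)"
    by (rule measure_finite_Union[symmetric])
       (use disj Tf in \<open>auto simp: fmeasurable_def image_subset_iff less_top\<close>)
  also have "\<dots> \<le> measure lborel (ball (0::'a) (R + 1))"
  proof (rule measure_mono_fmeasurable)
    show "(\<Union>j<N. ?T j) \<subseteq> ball 0 (R + 1)"
    proof clarsimp
      fix j x assume j: "j < N" and x: "x \<in> S"
      have "7 * r * real j \<le> 7 * r * real N" using j r by (intro mult_left_mono) auto
      then have "7 * r * real j \<le> 1" using N by linarith
      then have "norm ((7 * r * real j) *\<^sub>R u) \<le> 1" using r u by simp
      moreover have "norm x < R" using x by (simp add: S_def)
      ultimately show "norm ((7 * r * real j) *\<^sub>R u + x) < R + 1"
        using norm_triangle_ineq[of "(7 * r * real j) *\<^sub>R u" x] by linarith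
    qed
    show "(\<Union>j<N. ?T j) \<in> sets lborel" using Tb by auto
    show "ball 0 (R + 1) \<in> fmeasurable lborel" by (intro fmeasurable_bounded_borel) auto
  qed
  finally show ?thesis .
qed

section \<open>Points missed by two convex sets\<close>

lemma convex_separating_unit_normal:
  fixes X :: "'a::euclidean_space set"
  assumes "convex X" "X \<noteq> {}" "p \<notin> X"
  obtains u where "norm u = 1" "\<And>x. x \<in> X \<Longrightarrow> u \<bullet> (x - p) \<le> 0"
proof -
  obtain a b where a: "a \<noteq> 0" "\<forall>x\<in>X. a \<bullet> x \<le> b" "\<forall>x\<in>{p}. a \<bullet> x \<ge> b"
    using separating_hyperplane_sets[of X "{p}"] assms by auto
  show thesis
  proof (rule that[of "sgn a"])
    show "norm (sgn a) = 1" using a by (simp add: norm_sgn)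
    fix x assume "x \<in> X"
    then have "a \<bullet> (x - p) \<le> 0" using a by (auto simp: inner_diff_right intro: order_trans)
    then show "sgn a \<bullet> (x - p) \<le> 0"
      by (simp add: sgn_div_norm divide_nonpos_nonneg inverse_eq_divide mult_nonneg_nonpos)
  qed
qed

text \<open>Cauchy-Schwarz against the unit vector \<open>u\<close>. This turns a separating normal
  at \<open>p\<close> into a quantitative lower bound for the distance to \<open>X\<close>.\<close>

lemma infdist_ge_halfspace:
  fixes X :: "'a::euclidean_space set"
  assumes "norm u = 1" "\<And>x. x \<in> X \<Longrightarrow> u \<bullet> (x - p) \<le> 0" "X \<noteq> {}"
  shows "u \<bullet> (z - p) \<le> infdist z X"
  unfolding infdist_notempty[OF assms(3)]
proof (rule cINF_greatest[OF assms(3)])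
  fix x assume x: "x \<in> X"
  have "u \<bullet> (z - p) = u \<bullet> (z - x) + u \<bullet> (x - p)" by (simp add: inner_diff_right)
  also have "\<dots> \<le> u \<bullet> (z - x)" using assms(2)[OF x] by simp
  also have "\<dots> \<le> norm u * norm (z - x)" by (rule norm_cauchy_schwarz)
  finally show "u \<bullet> (z - p) \<le> dist z x" using assms(1) by (simp add: dist_norm)
qed

text \<open>The \<open>r\<close>-deep points of \<open>P\<close> missed by both convex sets form a thin layer: at one such
  point \<open>p\<close> the outer normals \<open>u\<close>, \<open>w\<close> of the two sets must be nearly opposite, since otherwise
  moving from \<open>p\<close> in direction \<open>u + w\<close> would leave both neighbourhoods; and a missed point on
  the \<open>u\<close>-side of \<open>p\<close> is far from \<open>X\<close>, hence would have to lie in \<open>Y\<close>.\<close>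

lemma uncovered_deep_points_in_slab:
  fixes P X Y :: "'a::euclidean_space set"
  assumes X: "convex X" "X \<noteq> {}" and Y: "convex Y" "Y \<noteq> {}"
    and P: "P \<subseteq> ball 0 R"
    and cov: "\<And>x. x \<in> P \<Longrightarrow> infdist x X \<le> \<delta> \<or> infdist x Y \<le> \<delta>"
    and r: "r > 0" "\<delta> < r" "4 * R * \<delta> \<le> r\<^sup>2" and \<delta>: "\<delta> > 0"
    and p: "cball p r \<subseteq> P" "p \<notin> X \<union> Y"
  obtains u where "norm u = 1"
    "\<And>q. cball q r \<subseteq> P \<Longrightarrow> q \<notin> X \<union> Y \<Longrightarrow> \<bar>u \<bullet> (q - p)\<bar> \<le> 3 * r"
proof -
  obtain u where u: "norm u = 1" "\<And>x. x \<in> X \<Longrightarrow> u \<bullet> (x - p) \<le> 0"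
    using convex_separating_unit_normal[OF X] p(2) by blast
  obtain w where w: "norm w = 1" "\<And>y. y \<in> Y \<Longrightarrow> w \<bullet> (y - p) \<le> 0"
    using convex_separating_unit_normal[OF Y] p(2) by blast
  note dX = infdist_ge_halfspace[OF u X(2)] and dY = infdist_ge_halfspace[OF w Y(2)]
  have uw: "r * norm (u + w) \<le> 2 * \<delta>"
  proof (rule ccontr)
    assume far: "\<not> r * norm (u + w) \<le> 2 * \<delta>"
    \<comment> \<open>For unit vectors \<open>u\<close> and \<open>w\<close>, both
      \<open>u \<bullet> (u + w)\<close> and \<open>w \<bullet> (u + w)\<close> equal half the
      squared norm of \<open>u + w\<close>. So \<open>z\<close>, which stays in
      \<open>cball p r\<close>, has distance at least \<open>r * norm (u + w) / 2 > \<delta>\<close>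
      from both \<open>X\<close> and \<open>Y\<close>.\<close>
    define z where "z = p + r *\<^sub>R sgn (u + w)"
    have nz: "u + w \<noteq> 0" using far \<delta> by auto
    have *: "a \<bullet> (z - p) = r * norm (u + w) / 2"
      if "a = u \<and> b = w \<or> a = w \<and> b = u" for a b
    proof -
      have "(norm (u + w))\<^sup>2 = 2 * (a \<bullet> (u + w))"
        using that u(1) w(1) dot_square_norm[of u] dot_square_norm[of w]
        by (auto simp: power2_norm_eq_inner inner_add_left inner_add_right inner_commute)
      then have "a \<bullet> (u + w) = norm (u + w) * norm (u + w) / 2" by (simp add: power2_eq_square)
      then show ?thesis using nz by (simp add: z_def sgn_div_norm)
    qed
    have "infdist z X > \<delta>" "infdist z Y > \<delta>"
      using dX[of z] dY[of z] *[of u w] *[of w u] far by auto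
    moreover have "z \<in> P" using p(1) r(1) nz by (auto simp: z_def dist_norm norm_sgn subset_iff)
    ultimately show False using cov[of z] by auto
  qed
  \<comment> \<open>New normals \<open>u'\<close>, \<open>w'\<close> are taken at \<open>q\<close>.
    Moving from \<open>q\<close> by \<open>r > \<delta>\<close> along \<open>w'\<close> leaves the
    \<open>\<delta>\<close>-neighbourhood of \<open>Y\<close>, so the new point must be
    \<open>\<delta>\<close>-close to \<open>X\<close>. The move lowers
    \<open>u \<bullet> (q - p)\<close> by at most \<open>r\<close>, whence the bound
    \<open>r + \<delta> \<le> 2 * r\<close>. The bound for \<open>w\<close> is symmetric, with
    \<open>u'\<close>.\<close>
  have side: "u \<bullet> (q - p) \<le> 2 * r \<and> w \<bullet> (q - p) \<le> 2 * r" if q: "cball q r \<subseteq> P" "q \<notin> X \<union> Y" for q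
  proof -
    obtain u' where u': "norm u' = 1" "\<And>x. x \<in> X \<Longrightarrow> u' \<bullet> (x - q) \<le> 0"
      using convex_separating_unit_normal[OF X] q(2) by blast
    obtain w' where w': "norm w' = 1" "\<And>y. y \<in> Y \<Longrightarrow> w' \<bullet> (y - q) \<le> 0"
      using convex_separating_unit_normal[OF Y] q(2) by blast
    have in_P: "q + r *\<^sub>R a \<in> P" if "norm a = 1" for a
      using q(1) r(1) that by (auto simp: dist_norm subset_iff)
    have diff: "b \<bullet> (q + r *\<^sub>R a - p) \<ge> b \<bullet> (q - p) - r" if "norm a = 1" "norm b = 1" for a b
    proof -
      have "\<bar>b \<bullet> a\<bar> \<le> 1" using Cauchy_Schwarz_ineq2[of b a] that by simp
      then have "r * (b \<bullet> a) \<ge> r * (-1)" using r(1) by (intro mult_left_mono) auto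
      then show ?thesis by (simp add: inner_add_right inner_diff_right)
    qed
    have self: "a \<bullet> (q + r *\<^sub>R a - q) = r" if "norm a = 1" for a
      using that by (simp add: dot_square_norm)
    have "infdist (q + r *\<^sub>R w') Y > \<delta>"
      using infdist_ge_halfspace[OF w' Y(2), of "q + r *\<^sub>R w'"] self[OF w'(1)] r(2) by linarith
    then have "infdist (q + r *\<^sub>R w') X \<le> \<delta>" using cov[OF in_P[OF w'(1)]] by linarith
    then have 1: "u \<bullet> (q - p) \<le> 2 * r"
      using dX[of "q + r *\<^sub>R w'"] diff[OF w'(1) u(1)] r(2) by linarith
    have "infdist (q + r *\<^sub>R u') X > \<delta>"
      using infdist_ge_halfspace[OF u' X(2), of "q + r *\<^sub>R u'"] self[OF u'(1)] r(2) by linarith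
    then have "infdist (q + r *\<^sub>R u') Y \<le> \<delta>" using cov[OF in_P[OF u'(1)]] by linarith
    then have "w \<bullet> (q - p) \<le> 2 * r"
      using dY[of "q + r *\<^sub>R u'"] diff[OF u'(1) w(1)] r(2) by linarith
    with 1 show ?thesis by blast
  qed
  show thesis
  proof (rule that[OF u(1)])
    \<comment> \<open>\<open>side\<close> gives only upper bounds. The lower bound for
      \<open>u\<close> comes from the one for \<open>w\<close>, since \<open>u + w\<close> is so
      short that \<open>(u + w) \<bullet> (q - p)\<close> is at most \<open>r\<close> in absolute
      value: \<open>-r - 2 * r\<close> is the worst case.\<close>
    fix q assume q: "cball q r \<subseteq> P" "q \<notin> X \<union> Y"
    have "q \<in> P" "p \<in> P" using q(1) p(1) r(1) by auto
    then have "norm q < R" "norm p < R" using P by auto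
    then have "norm (q - p) \<le> 2 * R" using norm_triangle_ineq4[of q p] by linarith
    then have "norm (u + w) * norm (q - p) \<le> norm (u + w) * (2 * R)" by (intro mult_left_mono) auto
    then have "\<bar>(u + w) \<bullet> (q - p)\<bar> \<le> norm (u + w) * (2 * R)"
      using Cauchy_Schwarz_ineq2[of "u + w" "q - p"] by linarith
    also have "\<dots> \<le> r"
    proof -
      have "R > 0" using \<open>p \<in> P\<close> P by (smt (verit) dist_0_norm mem_ball norm_ge_zero subset_iff)
      then have "r * norm (u + w) * (2 * R) \<le> 2 * \<delta> * (2 * R)" using uw by (intro mult_right_mono) auto
      also have "\<dots> \<le> r * r" using r(3) by (simp add: power2_eq_square algebra_simps)
      finally have "r * (norm (u + w) * (2 * R)) \<le> r * r" by (simp add: algebra_simps)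
      then show ?thesis using r(1) by simp
    qed
    finally show "\<bar>u \<bullet> (q - p)\<bar> \<le> 3 * r"
      using side[OF q] r(1) by (auto simp: inner_add_left abs_le_iff)
  qed
qed

text \<open>The shallow points of \<open>P\<close> and the slab containing the deep missed points
  each contribute less than \<open>\<epsilon> / 2\<close>. It matters that \<open>\<delta>\<close>
  is chosen before \<open>X\<close> and \<open>Y\<close>; the slab may depend on them, but its
  volume bound does not.\<close>

lemma measure_uncovered_small:
  fixes P :: "'a::euclidean_space set"
  assumes P: "open P" "bounded P" and \<epsilon>: "\<epsilon> > 0"
  obtains \<delta> where "\<delta> > 0"
    "\<And>X Y. convex X \<Longrightarrow> X \<noteq> {} \<Longrightarrow> open X \<Longrightarrow> convex Y \<Longrightarrow> Y \<noteq> {} \<Longrightarrow> open Y \<Longrightarrow>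
       (\<And>x. x \<in> P \<Longrightarrow> infdist x X \<le> \<delta> \<or> infdist x Y \<le> \<delta>) \<Longrightarrow>
       measure lborel (P - (X \<union> Y)) < \<epsilon>"
proof -
  obtain R where R: "R > 0" "P \<subseteq> ball 0 R"
    using bounded_subset_ballD[OF P(2)] by blast
  \<comment> \<open>Needed for \<open>pos\<close>: \<open>infdist\<close> to the empty set is
    \<open>0\<close> by convention.\<close>
  have nP: "- P \<noteq> {}" using P(2) not_bounded_UNIV by (metis Compl_empty_eq double_complement)
  have Pf: "P \<in> fmeasurable lborel" using P by (intro fmeasurable_bounded_borel) auto
  have \<epsilon>2: "\<epsilon> / 2 > 0" using \<epsilon> by simp
  have pos: "infdist x (- P) > 0" if "x \<in> P" for x
    using that P(1) nP in_closed_iff_infdist_zero[of "- P" x] infdist_nonneg[of x "- P"]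
    by (auto simp: closed_Compl less_le)
  obtain r0 where r0: "r0 > 0" "measure lborel {x \<in> P. infdist x (- P) \<le> r0} < \<epsilon> / 2"
    by (rule sublevel_measure_small[OF Pf infdist_borel pos \<epsilon>2])
  let ?V = "measure lborel (ball (0::'a) (R + 1))"
  \<comment> \<open>\<open>N\<close> disjoint translates of the slab will fit into a ball of volume
    \<open>?V\<close>, so each has volume below \<open>\<epsilon> / 2\<close>.\<close>
  obtain N :: nat where N: "?V < real N * (\<epsilon> / 2)"
    using reals_Archimedean3[of "\<epsilon> / 2"] \<epsilon> by auto
  then have N0: "N > 0" using measure_nonneg[of lborel "ball (0::'a) (R + 1)"] by (cases N) auto
  \<comment> \<open>\<open>r \<le> r0\<close> puts \<open>cball x r\<close> inside \<open>P\<close>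
    for every \<open>x\<close> outside the shallow layer; the other bound keeps the total shift of
    the \<open>N\<close> translates at most \<open>1\<close>.\<close>
  define r where "r = min r0 (1 / (7 * real N))"
  have r: "r > 0" "r \<le> r0" using r0 N0 by (auto simp: r_def)
  have rN: "7 * r * real N \<le> 1"
  proof -
    have "r \<le> 1 / (7 * real N)" by (simp add: r_def)
    then show ?thesis using N0 by (simp add: field_simps)
  qed
  \<comment> \<open>The first bound makes \<open>\<delta>\<close> strictly less than
    \<open>r\<close>, the second makes the two normals sufficiently opposite on the scale of
    \<open>R\<close>.\<close>
  define \<delta> where "\<delta> = min (r / 2) (r\<^sup>2 / (4 * R))"
  have \<delta>: "\<delta> > 0" "\<delta> < r" using r R by (auto simp: \<delta>_def)
  have \<delta>R: "4 * R * \<delta> \<le> r\<^sup>2"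
  proof -
    have "\<delta> \<le> r\<^sup>2 / (4 * R)" by (simp add: \<delta>_def)
    then show ?thesis using R by (simp add: field_simps)
  qed
  show thesis
  proof (rule that[OF \<delta>(1)])
    fix X Y :: "'a set"
    assume X: "convex X" "X \<noteq> {}" "open X" and Y: "convex Y" "Y \<noteq> {}" "open Y"
      and cov: "\<And>x. x \<in> P \<Longrightarrow> infdist x X \<le> \<delta> \<or> infdist x Y \<le> \<delta>"
    let ?shallow = "{x \<in> P. infdist x (- P) \<le> r0}"
    have deep: "cball x r \<subseteq> P" if "x \<in> P" "x \<notin> ?shallow" for x
    proof
      fix y assume "y \<in> cball x r"
      then have "\<not> infdist x (- P) \<le> dist x y" using that r by auto
      then show "y \<in> P" using infdist_le[of y "- P" x] by auto
    qed
    have "closed {x. infdist x (- P) \<le> r0}" by (intro closed_Collect_le continuous_intros)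
    moreover have "?shallow = P \<inter> {x. infdist x (- P) \<le> r0}" by auto
    ultimately have shb: "?shallow \<in> sets borel" using P(1) by auto
    show "measure lborel (P - (X \<union> Y)) < \<epsilon>"
    proof (cases "P - (X \<union> Y) \<subseteq> ?shallow")
      case True
      then have "measure lborel (P - (X \<union> Y)) \<le> measure lborel ?shallow"
        using P X Y shb
        by (intro measure_mono_fmeasurable fmeasurable_bounded_borel bounded_subset[OF P(2)]) auto
      then show ?thesis using r0 \<epsilon> by linarith
    next
      case False
      then obtain p where p: "p \<in> P" "p \<notin> ?shallow" "p \<notin> X \<union> Y" by blast
      obtain u where u: "norm u = 1"
          "\<And>q. cball q r \<subseteq> P \<Longrightarrow> q \<notin> X \<union> Y \<Longrightarrow> \<bar>u \<bullet> (q - p)\<bar> \<le> 3 * r"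
        using uncovered_deep_points_in_slab[OF X(1,2) Y(1,2) R(2) cov r(1) \<delta>(2) \<delta>R \<delta>(1)
            deep[OF p(1,2)] p(3)] by blast
      let ?S = "{x \<in> ball 0 R. \<bar>u \<bullet> (x - p)\<bar> \<le> 3 * r}"
      have "closed {x. \<bar>u \<bullet> (x - p)\<bar> \<le> 3 * r}" by (intro closed_Collect_le continuous_intros)
      moreover have "?S = ball 0 R \<inter> {x. \<bar>u \<bullet> (x - p)\<bar> \<le> 3 * r}" by auto
      ultimately have Sb: "?S \<in> sets borel" by auto
      have sub: "P - (X \<union> Y) \<subseteq> ?shallow \<union> ?S"
        using u(2) deep R(2) by blast
      have "real N * measure lborel ?S < real N * (\<epsilon> / 2)"
        using slab_measure_le[OF u(1) r(1) rN, of R p] N by linarith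
      then have S: "measure lborel ?S < \<epsilon> / 2" using N0 by simp
      have "bounded (?shallow \<union> ?S)"
        by (rule bounded_subset[of "ball 0 R"]) (use R(2) in auto)
      then have "measure lborel (P - (X \<union> Y)) \<le> measure lborel (?shallow \<union> ?S)"
        using P X Y shb Sb sub by (intro measure_mono_fmeasurable fmeasurable_bounded_borel) auto
      also have "\<dots> \<le> measure lborel ?shallow + measure lborel ?S"
        using shb Sb by (intro measure_Un_le) auto
      finally show ?thesis using r0(2) S by linarith
    qed
  qed
qed

section \<open>Hausdorff closeness implies closeness in volume\<close>

text \<open>A convex region is written as its union with itself, so that regions with one and with
  two components are treated alike.\<close>

lemma region_space_cases:
  assumes "P \<in> region_space"
  obtains X Y where "P = X \<union> Y" "convex X" "convex Y" "region X" "region Y"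
proof -
  consider "P \<in> convex_regions" | "P \<in> convex_region_pairs"
    using assms by (auto simp: region_space_def)
  then show thesis
  proof cases
    case 1
    then show ?thesis using that[of P P] by (simp add: convex_regions_def)
  next
    case 2
    then obtain X Y where "P = X \<union> Y" "X \<in> convex_regions" "Y \<in> convex_regions"
      unfolding convex_region_pairs_def by auto
    then show ?thesis using that[of X Y] by (simp add: convex_regions_def)
  qed
qed

lemma infdist_Un_cases:
  assumes "infdist x (A \<union> B) \<le> d" "A \<noteq> {}" "B \<noteq> {}"
  shows "infdist x A \<le> d \<or> infdist x B \<le> d"
  using assms by (simp add: infdist_Un_min min_le_iff_disj)

text \<open>Points of \<open>Q - P\<close> in \<open>closure P\<close> lie on the frontiers of two
  convex sets, which are null. The others have positive distance to \<open>P\<close>, and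
  \<open>sublevel_measure_small\<close> applies.\<close>

lemma measure_outer_layer_small:
  fixes P :: "'a::euclidean_space set"
  assumes P: "P \<in> region_space" and \<epsilon>: "\<epsilon> > 0"
  obtains \<delta> where "\<delta> > 0"
    "\<And>Q. open Q \<Longrightarrow> (\<And>x. x \<in> Q \<Longrightarrow> infdist x P \<le> \<delta>) \<Longrightarrow> measure lborel (Q - P) < \<epsilon>"
proof -
  have regP: "region P" using P by (rule region_space_region)
  then have P': "P \<noteq> {}" "bounded P" "open P" by (auto simp: region_def)
  obtain A B where AB: "P = A \<union> B" "convex A" "convex B" "region A" "region B"
    using P by (rule region_space_cases)
  have fr: "frontier A \<in> null_sets lborel" if "convex A" for A :: "'a set"
  proof -
    have "frontier A \<in> null_sets lebesgue"
      using negligible_convex_frontier[OF that] negligible_iff_null_sets by blast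
    then show ?thesis by (subst (asm) null_sets_completion_iff) auto
  qed
  have "closure P - P \<subseteq> frontier A \<union> frontier B"
    using AB by (auto simp: frontier_def region_def interior_open)
  then have null: "closure P - P \<in> null_sets lborel"
    using fr[OF AB(2)] fr[OF AB(3)] P'
    by (intro null_sets_subset[of "frontier A \<union> frontier B" lborel "closure P - P"] null_sets.Un) auto
  \<comment> \<open>The cutoff at distance \<open>1\<close> provides a set of finite measure; it is
    the reason for \<open>min r 1\<close> below.\<close>
  let ?S = "{x. infdist x P \<le> 1} - closure P"
  have cl: "closed {x. infdist x P \<le> d}" for d
    by (intro closed_Collect_le continuous_intros)
  have bdd: "bounded {x. infdist x P \<le> 1}"
    using compact_infdist_le[of "closure P" 1] P'
    by (auto simp: infdist_closure compact_closure intro: compact_imp_bounded)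
  have Sf: "?S \<in> fmeasurable lborel"
    using cl[of 1] bounded_subset[OF bdd, of ?S] by (intro fmeasurable_bounded_borel) auto
  have pos: "infdist x P > 0" if "x \<in> ?S" for x
    using that P' in_closure_iff_infdist_zero[of P x] infdist_nonneg[of x P] by (auto simp: less_le)
  obtain r where r: "r > 0" "measure lborel {x \<in> ?S. infdist x P \<le> r} < \<epsilon>"
    by (rule sublevel_measure_small[OF Sf infdist_borel pos \<epsilon>])
  show thesis
  proof (rule that[of "min r 1"])
    show "min r 1 > 0" using r by simp
    fix Q :: "'a set" assume Q: "open Q" "\<And>x. x \<in> Q \<Longrightarrow> infdist x P \<le> min r 1"
    let ?L = "{x \<in> ?S. infdist x P \<le> r}"
    have "?L = ?S \<inter> {x. infdist x P \<le> r}" by auto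
    then have Lb: "?L \<in> sets borel" using cl[of r] cl[of 1] by auto
    have "Q - P \<subseteq> ?L \<union> (closure P - P)" using Q(2) by force
    then have "measure lborel (Q - P) \<le> measure lborel (?L \<union> (closure P - P))"
      using Q(1) P' Lb bounded_subset[OF bdd, of ?L]
      by (intro measure_mono_fmeasurable fmeasurable_bounded_borel)
         (auto intro: bounded_subset[OF bounded_closure])
    also have "\<dots> = measure lborel ?L"
      using null Lb by (intro measure_Un_null_set) auto
    finally show "measure lborel (Q - P) < \<epsilon>" using r(2) by linarith
  qed
qed

text \<open>Continuity at \<open>P\<close> of the identity map from the Hausdorff to the
  symmetric-difference metric; \<open>\<delta>\<close> depends on \<open>P\<close>.\<close>

lemma symdiff_dist_small_if_hausdorff_dist_small:
  fixes P :: "'a::euclidean_space set"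
  assumes P: "P \<in> region_space" and \<epsilon>: "\<epsilon> > 0"
  obtains \<delta> where "\<delta> > 0"
    "\<And>Q. Q \<in> region_space \<Longrightarrow> hausdorff_dist P Q < \<delta> \<Longrightarrow> symdiff_dist P Q < \<epsilon>"
proof -
  have regP: "region P" using P by (rule region_space_region)
  then have P': "P \<noteq> {}" "bounded P" "open P" by (auto simp: region_def)
  have \<epsilon>2: "\<epsilon> / 2 > 0" using \<epsilon> by simp
  obtain \<delta>1 where \<delta>1: "\<delta>1 > 0" "\<And>X Y. convex X \<Longrightarrow> X \<noteq> {} \<Longrightarrow> open X \<Longrightarrow> convex Y \<Longrightarrow> Y \<noteq> {} \<Longrightarrow> open Y \<Longrightarrow>
       (\<And>x. x \<in> P \<Longrightarrow> infdist x X \<le> \<delta>1 \<or> infdist x Y \<le> \<delta>1) \<Longrightarrow>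
       measure lborel (P - (X \<union> Y)) < \<epsilon> / 2"
    using measure_uncovered_small[OF P'(3,2) \<epsilon>2] by blast
  obtain \<delta>2 where \<delta>2: "\<delta>2 > 0"
    "\<And>Q. open Q \<Longrightarrow> (\<And>x. x \<in> Q \<Longrightarrow> infdist x P \<le> \<delta>2) \<Longrightarrow> measure lborel (Q - P) < \<epsilon> / 2"
    using measure_outer_layer_small[OF P \<epsilon>2] by blast
  show thesis
  proof (rule that[of "min \<delta>1 \<delta>2"])
    show "min \<delta>1 \<delta>2 > 0" using \<delta>1 \<delta>2 by simp
    fix Q :: "'a set" assume Q: "Q \<in> region_space" and H: "hausdorff_dist P Q < min \<delta>1 \<delta>2"
    have regQ: "region Q" using Q by (rule region_space_region)
    then have Q': "Q \<noteq> {}" "bounded Q" "open Q" by (auto simp: region_def)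
    have PQ: "infdist x Q \<le> \<delta>1" if "x \<in> P" for x
      using point_region_dist_le_semidist[OF regP regQ, of x] that closure_subset[of P] H
      by (auto simp: point_region_dist_def hausdorff_dist_def infdist_closure)
    have QP: "infdist x P \<le> \<delta>2" if "x \<in> Q" for x
      using point_region_dist_le_semidist[OF regQ regP, of x] that closure_subset[of Q] H
      by (auto simp: point_region_dist_def hausdorff_dist_def infdist_closure)
    obtain X Y where XY: "Q = X \<union> Y" "convex X" "convex Y" "region X" "region Y"
      using Q by (rule region_space_cases)
    have ne: "X \<noteq> {}" "Y \<noteq> {}" "open X" "open Y" using XY by (auto simp: region_def)
    have 1: "measure lborel (P - Q) < \<epsilon> / 2"
      unfolding XY(1)
    proof (rule \<delta>1(2)[OF XY(2) ne(1) ne(3) XY(3) ne(2) ne(4)])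
      show "infdist x X \<le> \<delta>1 \<or> infdist x Y \<le> \<delta>1" if "x \<in> P" for x
        using infdist_Un_cases[OF _ ne(1,2)] PQ[OF that] XY(1) by blast
    qed
    have 2: "measure lborel (Q - P) < \<epsilon> / 2" by (rule \<delta>2(2)[OF Q'(3) QP])
    have "symdiff_dist P Q \<le> measure lborel (P - Q) + measure lborel (Q - P)"
      unfolding symdiff_dist_def using P' Q' by (intro measure_Un_le) auto
    then show "symdiff_dist P Q < \<epsilon>" using 1 2 by linarith
  qed
qed

lemma openin_symdiff_imp_openin_hausdorff:
  fixes U :: "'a::euclidean_space set set"
  assumes "openin symdiff_topology U"
  shows "openin hausdorff_topology U"
proof -
  interpret H: Metric_space "region_space :: 'a set set" "restrict_dist region_space hausdorff_dist"
    by (rule Metric_space_hausdorff_dist)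
  interpret V: Metric_space "region_space :: 'a set set" "restrict_dist region_space symdiff_dist"
    by (rule Metric_space_symdiff_dist)
  have U: "U \<subseteq> region_space" "\<And>P. P \<in> U \<Longrightarrow> \<exists>\<epsilon>>0. V.mball P \<epsilon> \<subseteq> U"
    using assms by (auto simp: symdiff_topology_def V.openin_mtopology)
  have "\<exists>\<delta>>0. H.mball P \<delta> \<subseteq> U" if PU: "P \<in> U" for P
  proof -
    have P: "P \<in> region_space" using PU U by blast
    obtain \<epsilon> where \<epsilon>: "\<epsilon> > 0" "V.mball P \<epsilon> \<subseteq> U" using U(2)[OF PU] by blast
    obtain \<delta> where \<delta>: "\<delta> > 0"
        "\<And>Q. Q \<in> region_space \<Longrightarrow> hausdorff_dist P Q < \<delta> \<Longrightarrow> symdiff_dist P Q < \<epsilon>"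
      using symdiff_dist_small_if_hausdorff_dist_small[OF P \<epsilon>(1)] by blast
    have "H.mball P \<delta> \<subseteq> V.mball P \<epsilon>"
    proof
      fix Q assume "Q \<in> H.mball P \<delta>"
      then have "Q \<in> region_space" "hausdorff_dist P Q < \<delta>"
        unfolding H.in_mball by (auto simp: restrict_dist_def split: if_splits)
      then show "Q \<in> V.mball P \<epsilon>"
        unfolding V.in_mball using P \<delta>(2) by (simp add: restrict_dist_def)
    qed
    then show ?thesis using \<delta>(1) \<epsilon>(2) by blast
  qed
  then show ?thesis using U(1) by (auto simp: hausdorff_topology_def H.openin_mtopology)
qed

section \<open>Failure of the converse\<close>

lemma ball_in_convex_regions:
  fixes c :: "'a::euclidean_space"
  assumes "r > 0"
  shows "ball c r \<in> convex_regions"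
  using assms by (auto simp: convex_regions_def region_def closure_ball interior_cball)

text \<open>The volume of the speck tends to \<open>0\<close> with \<open>r\<close>, while its
  centre \<open>c\<close> stays at distance \<open>4 - 1 = 3\<close> from the unit ball.\<close>

lemma ball_with_distant_speck:
  fixes c :: "'a::euclidean_space"
  assumes c: "norm c = 4" and \<epsilon>: "\<epsilon> > 0"
  obtains r where "ball 0 1 \<union> ball c r \<in> region_space"
    "symdiff_dist (ball 0 1) (ball 0 1 \<union> ball c r) < \<epsilon>"
    "hausdorff_dist (ball 0 1) (ball 0 1 \<union> ball c r) \<ge> 3"
proof -
  let ?k = "measure lborel (ball (0::'a) 1)"
  \<comment> \<open>\<open>r \<le> 1\<close> keeps the closed balls at distance at least
    \<open>4 - 1 - 1 = 2\<close> and gives \<open>r ^ DIM('a) \<le> r\<close>; the other bound gives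
    \<open>?k * r < \<epsilon>\<close>.\<close>
  define r where "r = min 1 (\<epsilon> / (?k + 1))"
  have k: "?k > 0" by (rule content_ball_pos) simp
  have r: "r > 0" "r \<le> 1" using \<epsilon> k by (simp_all add: r_def divide_pos_pos add_pos_pos)
  have "r * (?k + 1) \<le> \<epsilon>"
  proof -
    have "r \<le> \<epsilon> / (?k + 1)" by (simp add: r_def)
    then show ?thesis using k by (simp add: field_simps)
  qed
  then have kr: "?k * r < \<epsilon>" using r by (simp add: algebra_simps)
  have far: "2 \<le> dist x y" if "x \<in> cball 0 1" "y \<in> cball c r" for x y
    using that r c dist_triangle[of 0 c x] dist_triangle[of x c y]
    by (auto simp: dist_commute)
  have disj: "cball (0::'a) 1 \<inter> cball c r = {}"
    using far by force
  have "setdist (cball (0::'a) 1) (cball c r) > 0"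
    using r disj by (subst setdist_gt_0_compact_closed) auto
  then have "region_dist (ball (0::'a) 1) (ball c r) > 0"
    using r by (simp add: region_dist_def closure_ball)
  then have mem: "ball 0 1 \<union> ball c r \<in> region_space"
    unfolding region_space_def convex_region_pairs_def
    by (intro UnI2 CollectI exI conjI) (rule refl, use r in \<open>simp_all add: ball_in_convex_regions\<close>)
  have "(ball 0 1 - (ball 0 1 \<union> ball c r)) \<union> ((ball 0 1 \<union> ball c r) - ball 0 1) = ball c r"
    using disj ball_subset_cball[of "0::'a" 1] ball_subset_cball[of c r] by fast
  then have "symdiff_dist (ball 0 1) (ball 0 1 \<union> ball c r) = ?k * r ^ DIM('a)"
    using r by (simp add: symdiff_dist_def content_ball_conv_unit_ball[of r c])
  also have "\<dots> \<le> ?k * r"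
    using r power_decreasing[of 1 "DIM('a)" r] by (intro mult_left_mono) auto
  finally have sd: "symdiff_dist (ball 0 1) (ball 0 1 \<union> ball c r) < \<epsilon>" using kr by linarith
  have reg: "region (ball 0 1 \<union> ball c r)" "region (ball (0::'a) 1)"
    using mem ball_in_convex_regions[of 1 "0::'a"] by (auto intro: region_space_region simp: convex_regions_def)
  have "3 \<le> infdist c (cball 0 1)"
  proof -
    have "3 \<le> dist c x" if "x \<in> cball 0 1" for x
      using that c dist_triangle[of 0 c x] by (simp add: dist_commute)
    then show ?thesis by (subst infdist_notempty) (auto intro!: cINF_greatest)
  qed
  also have "\<dots> \<le> hausdorff_semidist (ball 0 1 \<union> ball c r) (ball 0 1)"
    using point_region_dist_le_semidist[OF reg, of c] closure_subset[of "ball 0 1 \<union> ball c r"] r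
    by (auto simp: point_region_dist_def closure_ball)
  finally have "hausdorff_dist (ball 0 1) (ball 0 1 \<union> ball c r) \<ge> 3"
    by (simp add: hausdorff_dist_def)
  with mem sd show thesis by (rule that)
qed

theorem theorem11:
  assumes "CARD('n::finite) \<ge> 2"
  shows "strictly_coarser
           (symdiff_topology :: (real ^ 'n) set topology)
           (hausdorff_topology :: (real ^ 'n) set topology)"
proof -
  interpret H: Metric_space "region_space :: (real ^ 'n) set set" "restrict_dist region_space hausdorff_dist"
    by (rule Metric_space_hausdorff_dist)
  interpret V: Metric_space "region_space :: (real ^ 'n) set set" "restrict_dist region_space symdiff_dist"
    by (rule Metric_space_symdiff_dist)
  let ?B = "ball 0 1 :: (real ^ 'n) set"
  have B: "?B \<in> region_space"
    using ball_in_convex_regions[of 1 "0 :: real ^ 'n"] by (simp add: region_space_def)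
  obtain c :: "real ^ 'n" where c: "norm c = 4" using vector_choose_size[of 4] by auto
  \<comment> \<open>The separating open set: an open Hausdorff ball of radius \<open>3\<close>
    excludes every ball with a speck, however small the speck.\<close>
  have "openin hausdorff_topology (H.mball ?B 3)"
    unfolding hausdorff_topology_def by (rule H.openin_mball)
  moreover have "\<not> openin symdiff_topology (H.mball ?B 3)"
  proof
    assume "openin symdiff_topology (H.mball ?B 3)"
    moreover have "?B \<in> H.mball ?B 3" using B by simp
    ultimately obtain \<epsilon> where \<epsilon>: "\<epsilon> > 0" "V.mball ?B \<epsilon> \<subseteq> H.mball ?B 3"
      unfolding symdiff_topology_def V.openin_mtopology by blast
    obtain r where r: "?B \<union> ball c r \<in> region_space"
        "symdiff_dist ?B (?B \<union> ball c r) < \<epsilon>" "hausdorff_dist ?B (?B \<union> ball c r) \<ge> 3"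
      using ball_with_distant_speck[OF c \<epsilon>(1)] by blast
    have "?B \<union> ball c r \<in> V.mball ?B \<epsilon>"
      using r B unfolding V.in_mball by (simp add: restrict_dist_def)
    then have "?B \<union> ball c r \<in> H.mball ?B 3" using \<epsilon>(2) by blast
    then show False using r B unfolding H.in_mball by (simp add: restrict_dist_def)
  qed
  ultimately show ?thesis
    using openin_symdiff_imp_openin_hausdorff unfolding strictly_coarser_def by blast
qed

end
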